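(* Let $P$ be a finite set of $n$ points in general position in the plane and let $p,q\in P$ be distinct. A vertex $T$ of $G(P)$ is a $pq$-brush if and only if $T$ is not a star and $$d_{G(P)}(T,S(p))+d_{G(P)}(T,S(q))=n-2.$$
   Context: General position means no three points are collinear. $K(P)$ is the complete geometric graph on $P$ with straight-segment edges; two segments with four distinct endpoints cross if they intersect. An SST is a spanning tree of $K(P)$ no two of whose edges cross; spanning subgraphs are identified with their edge sets. $G(P)$ is the abstract graph whose vertices are the SSTs of $K(P)$, two SSTs $A,B$ being adjacent iff $|A\triangle B|=2$; $d_{G(P)}$ is the graph distance in $G(P)$. A star is a spanning tree of diameter 2; $S(x)$ denotes the spanning star of $K(P)$ centered at $x$ (all edges $[x,y]$, $y\ne x$). A $pq$-brush is an SST of diameter 3 whose only internal edge (edge with neither endpoint a leaf) is $[p,q]$; equivalently, an SST containing $[p,q]$ in which every other edge joins a point of $P\setminus\{p,q\}$ to $p$ or to $q$, with both $p$ and $q$ non-leaves. *)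

theory Defs
  imports "HOL-Analysis.Analysis" "HOL-Library.Extended_Nat"
begin

section \<open>Undirected graphs\<close>

text \<open>
  A graph is given by a vertex set \<open>V\<close> and an edge set \<open>E\<close> of two-element subsets of \<open>V\<close>.
\<close>

definition complete_edges :: "'a set \<Rightarrow> 'a set set" where
  "complete_edges V = {{x, y} | x y. x \<in> V \<and> y \<in> V \<and> x \<noteq> y}"

definition edge_adj :: "'a set set \<Rightarrow> 'a \<Rightarrow> 'a \<Rightarrow> bool" where
  "edge_adj E x y \<longleftrightarrow> x \<noteq> y \<and> {x, y} \<in> E"

text \<open>
  The least length of a walk along the adjacency relation \<open>R\<close>; it is \<open>\<infinity>\<close> if there is no walk.
\<close>

definition graph_dist :: "('a \<Rightarrow> 'a \<Rightarrow> bool) \<Rightarrow> 'a \<Rightarrow> 'a \<Rightarrow> enat" where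
  "graph_dist R x y = (INF k \<in> {k. (R ^^ k) x y}. enat k)"

definition graph_diameter :: "'a set \<Rightarrow> 'a set set \<Rightarrow> enat" where
  "graph_diameter V E = (SUP x \<in> V. SUP y \<in> V. graph_dist (edge_adj E) x y)"

definition graph_connected :: "'a set \<Rightarrow> 'a set set \<Rightarrow> bool" where
  "graph_connected V E \<longleftrightarrow> (\<forall>x\<in>V. \<forall>y\<in>V. (edge_adj E)\<^sup>*\<^sup>* x y)"

definition graph_cycle :: "'a set set \<Rightarrow> 'a list \<Rightarrow> bool" where
  "graph_cycle E xs \<longleftrightarrow> 3 \<le> length xs \<and> distinct xs \<and>
     successively (edge_adj E) xs \<and> edge_adj E (last xs) (hd xs)"

definition is_spanning_tree :: "'a set \<Rightarrow> 'a set set \<Rightarrow> bool" where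
  "is_spanning_tree V T \<longleftrightarrow> V \<noteq> {} \<and> T \<subseteq> complete_edges V \<and>
     graph_connected V T \<and> (\<nexists>xs. graph_cycle T xs)"

definition is_leaf :: "'a set set \<Rightarrow> 'a \<Rightarrow> bool" where
  "is_leaf T x \<longleftrightarrow> card {e \<in> T. x \<in> e} = 1"

definition internal_edges :: "'a set set \<Rightarrow> 'a set set" where
  "internal_edges T = {e \<in> T. \<forall>x\<in>e. \<not> is_leaf T x}"

definition spanning_star :: "'a set \<Rightarrow> 'a \<Rightarrow> 'a set set" where
  "spanning_star V x = {{x, y} | y. y \<in> V \<and> y \<noteq> x}"

text \<open>
  Every tree on at least three vertices has diameter at least 2, so there the bound says that the
  diameter is exactly 2.  The inequality also admits the spanning star on two points,
  whose diameter is 1.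
\<close>

definition is_star :: "'a set \<Rightarrow> 'a set set \<Rightarrow> bool" where
  "is_star V T \<longleftrightarrow> is_spanning_tree V T \<and> graph_diameter V T \<le> 2"


section \<open>Non-crossing spanning trees of a planar point set\<close>

definition general_position :: "(real^2) set \<Rightarrow> bool" where
  "general_position P \<longleftrightarrow>
     (\<forall>x\<in>P. \<forall>y\<in>P. \<forall>z\<in>P. distinct [x, y, z] \<longrightarrow> \<not> collinear {x, y, z})"

definition edges_cross :: "(real^2) set \<Rightarrow> (real^2) set \<Rightarrow> bool" where
  "edges_cross e f \<longleftrightarrow> (\<exists>a b c d. e = {a, b} \<and> f = {c, d} \<and> distinct [a, b, c, d] \<and>
     closed_segment a b \<inter> closed_segment c d \<noteq> {})"

definition SST :: "(real^2) set \<Rightarrow> (real^2) set set set" where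
  "SST P = {T. is_spanning_tree P T \<and> (\<forall>e\<in>T. \<forall>f\<in>T. \<not> edges_cross e f)}"

text \<open>The graph \<open>G(P)\<close> has vertex set \<open>SST P\<close> and the following adjacency relation.\<close>

definition sst_adj :: "(real^2) set \<Rightarrow> (real^2) set set \<Rightarrow> (real^2) set set \<Rightarrow> bool" where
  "sst_adj P A B \<longleftrightarrow> A \<in> SST P \<and> B \<in> SST P \<and> card (sym_diff A B) = 2"

definition sst_dist :: "(real^2) set \<Rightarrow> (real^2) set set \<Rightarrow> (real^2) set set \<Rightarrow> enat" where
  "sst_dist P = graph_dist (sst_adj P)"

definition is_brush :: "(real^2) set \<Rightarrow> real^2 \<Rightarrow> real^2 \<Rightarrow> (real^2) set set \<Rightarrow> bool" where
  "is_brush P p q T \<longleftrightarrow>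
     T \<in> SST P \<and> graph_diameter P T = 3 \<and> internal_edges T = {{p, q}}"

end

theory Submission
  imports Defs
begin

text \<open>
  An exchange of one edge changes the degree of \<open>p\<close> by at most one, so
  \<open>d(T, S(p)) \<ge> n - 1 - deg p\<close>.  If the two distances sum to \<open>n - 2\<close>, then
  \<open>deg p + deg q \<ge> n\<close>, and acyclicity leaves only the double stars with centres \<open>p\<close> and \<open>q\<close>.
  Conversely, a brush reaches \<open>S(p)\<close> by reattaching the neighbours of \<open>q\<close> to \<open>p\<close> one at a time:
  the neighbour \<open>b\<close> with the largest angle \<open>qpb\<close> can always be moved without creating a crossing.
\<close>

section \<open>Walks, paths and cycles\<close>

lemma edge_adj_commute: "edge_adj E x y \<longleftrightarrow> edge_adj E y x"
  by (auto simp: edge_adj_def insert_commute)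

lemma graph_dist_le:
  assumes "(R ^^ k) x y"
  shows "graph_dist R x y \<le> enat k"
  unfolding graph_dist_def using assms by (auto intro: INF_lower)

lemma graph_dist_ge:
  assumes "\<And>k. (R ^^ k) x y \<Longrightarrow> m \<le> enat k"
  shows "m \<le> graph_dist R x y"
  unfolding graph_dist_def using assms by (auto intro: INF_greatest)

text \<open>Dropping the pauses only shortens a walk. Distances can therefore be bounded using one
  walk length for all pairs of vertices.\<close>

lemma relpowp_reflclp:
  assumes "(R\<^sup>=\<^sup>= ^^ k) x y"
  shows "\<exists>j\<le>k. (R ^^ j) x y"
  using assms
proof (induction k arbitrary: y)
  case 0
  then show ?case by auto
next
  case (Suc k)
  then obtain z where z: "(R\<^sup>=\<^sup>= ^^ k) x z" "R\<^sup>=\<^sup>= z y"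
    by (blast elim: relpowp_Suc_E)
  with Suc.IH obtain j where j: "j \<le> k" "(R ^^ j) x z" by blast
  show ?case
  proof (cases "z = y")
    case True
    then show ?thesis using j le_SucI by blast
  next
    case False
    then have "(R ^^ Suc j) x y" using z j by auto
    then show ?thesis using j by (meson Suc_le_mono)
  qed
qed

lemma graph_dist_le_reflclp:
  assumes "(R\<^sup>=\<^sup>= ^^ k) x y"
  shows "graph_dist R x y \<le> enat k"
proof -
  obtain j where "j \<le> k" "(R ^^ j) x y" using relpowp_reflclp[OF assms] by blast
  then show ?thesis by (meson enat_ord_simps(1) graph_dist_le order_trans)
qed

lemma graph_diameter_le:
  assumes "\<And>x y. x \<in> V \<Longrightarrow> y \<in> V \<Longrightarrow> ((edge_adj E)\<^sup>=\<^sup>= ^^ k) x y"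
  shows "graph_diameter V E \<le> enat k"
  unfolding graph_diameter_def using assms
  by (auto intro!: SUP_least graph_dist_le_reflclp)

text \<open>If the new first vertex \<open>x\<close> already lies on the path, everything before its
  occurrence is cut off; otherwise \<open>x\<close> is prepended.\<close>

lemma rtranclp_imp_distinct_path:
  assumes "R\<^sup>*\<^sup>* x y"
  shows "\<exists>xs. xs \<noteq> [] \<and> distinct xs \<and> successively R xs \<and> hd xs = x \<and> last xs = y"
  using assms
proof (induction rule: converse_rtranclp_induct)
  case base
  have "[y] \<noteq> [] \<and> distinct [y] \<and> successively R [y] \<and> hd [y] = y \<and> last [y] = y" by simp
  then show ?case by blast
next
  case (step x z)
  then obtain xs where xs: "xs \<noteq> []" "distinct xs" "successively R xs" "hd xs = z" "last xs = y"
    by blast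
  show ?case
  proof (cases "x \<in> set xs")
    case True
    then obtain us vs where "xs = us @ x # vs" by (meson split_list)
    with xs have "distinct (x # vs)" "successively R (x # vs)" "last (x # vs) = y"
      by (auto simp: successively_append_iff)
    then show ?thesis by (metis list.sel(1) list.discI)
  next
    case False
    then have "distinct (x # xs)" "successively R (x # xs)" "last (x # xs) = y"
      using xs step(1) by (auto simp: successively_Cons)
    then show ?thesis by (metis list.sel(1) list.discI)
  qed
qed

text \<open>The neighbours are the predecessor and the successor of \<open>x\<close> in cyclic
  order; at an end of the list the closing edge supplies one of them. Length at least 3 keeps them
  distinct.\<close>

lemma graph_cycle_two_neighbours:
  assumes "graph_cycle E xs" and "x \<in> set xs"
  obtains y z where "y \<noteq> z" "edge_adj E x y" "edge_adj E x z"
proof -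
  have len: "3 \<le> length xs" and d: "distinct xs" and s: "successively (edge_adj E) xs"
    and c: "edge_adj E (last xs) (hd xs)"
    using assms(1) by (auto simp: graph_cycle_def)
  obtain us vs where xs: "xs = us @ x # vs" using assms(2) by (meson split_list)
  have hv: "edge_adj E x (hd vs)" if "vs \<noteq> []"
    using s that by (simp add: xs successively_append_iff successively_Cons)
  have lu: "edge_adj E x (last us)" if "us \<noteq> []"
    using s that by (simp add: xs successively_append_iff edge_adj_commute)
  consider "us = []" | "vs = []" | "us \<noteq> []" "vs \<noteq> []" by blast
  then show thesis
  proof cases
    case 1
    then obtain v w vs' where vs: "vs = v # w # vs'"
      using len xs by (auto simp: Suc_le_length_iff numeral_3_eq_3)
    have "edge_adj E x (last vs)" using c 1 vs by (simp add: xs edge_adj_commute)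
    moreover have "hd vs \<noteq> last vs" using d by (auto simp: xs vs)
    ultimately show thesis using that hv vs by blast
  next
    case 2
    then have "2 \<le> length us" using len xs by simp
    then obtain v w us' where us: "us = v # w # us'"
      by (auto simp: Suc_le_length_iff numeral_2_eq_2)
    have "edge_adj E x (hd us)" using c 2 us by (simp add: xs)
    moreover have "hd us \<noteq> last us" using d by (auto simp: xs us)
    ultimately show thesis using that lu us by blast
  next
    case 3
    then have "last us \<in> set us" "hd vs \<in> set vs" by auto
    then have "last us \<noteq> hd vs" using d by (auto simp: xs)
    then show thesis using that lu hv 3 by blast
  qed
qed

section \<open>Spanning trees\<close>

lemma complete_edgesI: "x \<in> V \<Longrightarrow> y \<in> V \<Longrightarrow> x \<noteq> y \<Longrightarrow> {x, y} \<in> complete_edges V"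
  unfolding complete_edges_def by blast

lemma spanning_tree_edge_adj:
  assumes "is_spanning_tree V T" and "{x, y} \<in> T"
  shows "edge_adj T x y" "x \<in> V" "y \<in> V"
  using assms by (auto simp: is_spanning_tree_def complete_edges_def edge_adj_def doubleton_eq_iff)

lemma spanning_tree_edgeE:
  assumes "is_spanning_tree V T" and "e \<in> T"
  obtains x y where "e = {x, y}" "x \<in> V" "y \<in> V" "x \<noteq> y"
  using assms unfolding is_spanning_tree_def complete_edges_def by blast

lemma finite_spanning_tree:
  assumes "finite V" and "is_spanning_tree V T"
  shows "finite T"
proof -
  have "T \<subseteq> Pow V" using spanning_tree_edgeE[OF assms(2)] by blast
  then show ?thesis using assms(1) by (meson finite_Pow_iff finite_subset)
qed

lemma spanning_tree_path:
  assumes "is_spanning_tree V T" and "x \<in> V" and "y \<in> V"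
  obtains xs where "xs \<noteq> []" "distinct xs" "successively (edge_adj T) xs" "hd xs = x" "last xs = y"
proof -
  have "(edge_adj T)\<^sup>*\<^sup>* x y"
    using assms by (auto simp: is_spanning_tree_def graph_connected_def)
  from rtranclp_imp_distinct_path[OF this] show thesis using that by blast
qed

text \<open>An edge of \<open>B\<close> outside \<open>A\<close> would close a cycle with the path
  of \<open>A\<close> between its ends. This takes the place of counting the edges of a
  tree.\<close>

lemma spanning_tree_subset_eq:
  assumes A: "is_spanning_tree V A" and B: "is_spanning_tree V B" and "A \<subseteq> B"
  shows "A = B"
proof (rule ccontr)
  assume "A \<noteq> B"
  then obtain e where e: "e \<in> B" "e \<notin> A" using \<open>A \<subseteq> B\<close> by blast
  then obtain x y where xy: "e = {x, y}" "x \<in> V" "y \<in> V" "x \<noteq> y"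
    using spanning_tree_edgeE[OF B] by blast
  obtain xs where xs: "xs \<noteq> []" "distinct xs" "successively (edge_adj A) xs" "hd xs = x" "last xs = y"
    using spanning_tree_path[OF A xy(2,3)] by blast
  \<comment> \<open>A path with one vertex would give \<open>x = y\<close>, and one with two
    vertices would put \<open>e\<close> into \<open>A\<close>.\<close>
  have "3 \<le> length xs"
  proof (rule ccontr)
    assume "\<not> 3 \<le> length xs"
    then consider "length xs = 1" | "length xs = Suc 1"
      using xs(1) by (cases xs) (auto simp: not_le less_Suc_eq numeral_3_eq_3)
    then show False
    proof cases
      case 1
      then show False using xs xy by (auto simp: length_Suc_conv)
    next
      case 2
      then have "xs = [x, y]" using xs by (auto simp: length_Suc_conv)
      then show False using xs e xy by (auto simp: edge_adj_def)
    qed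
  qed
  moreover have "successively (edge_adj B) xs"
    using xs(3) \<open>A \<subseteq> B\<close> by (auto intro: successively_mono simp: edge_adj_def)
  moreover have "edge_adj B (last xs) (hd xs)"
    using e xy xs by (auto simp: edge_adj_def insert_commute)
  ultimately have "graph_cycle B xs" using xs by (auto simp: graph_cycle_def)
  then show False using B by (auto simp: is_spanning_tree_def)
qed

lemma spanning_tree_no_triangle:
  assumes "is_spanning_tree V T" and "{x, y} \<in> T" "{y, z} \<in> T" "{z, x} \<in> T"
  shows False
proof -
  have "edge_adj T x y" "edge_adj T y z" "edge_adj T z x"
    using assms spanning_tree_edge_adj by metis+
  then have "graph_cycle T [x, y, z]" by (auto simp: graph_cycle_def edge_adj_def)
  then show False using assms by (auto simp: is_spanning_tree_def)
qed

lemma spanning_tree_no_square: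
  assumes "is_spanning_tree V T" and "{x, y} \<in> T" "{y, z} \<in> T" "{z, w} \<in> T" "{w, x} \<in> T"
    and "x \<noteq> z" "y \<noteq> w"
  shows False
proof -
  have "edge_adj T x y" "edge_adj T y z" "edge_adj T z w" "edge_adj T w x"
    using assms spanning_tree_edge_adj by metis+
  then have "graph_cycle T [x, y, z, w]" using assms by (auto simp: graph_cycle_def edge_adj_def)
  then show False using assms by (auto simp: is_spanning_tree_def)
qed

lemma card_incident_edges:
  assumes "is_spanning_tree V T"
  shows "card {e \<in> T. x \<in> e} = card {y. {x, y} \<in> T}"
proof -
  have "{e \<in> T. x \<in> e} = (\<lambda>y. {x, y}) ` {y. {x, y} \<in> T}"
  proof (intro equalityI subsetI)
    fix e assume e: "e \<in> {e \<in> T. x \<in> e}"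
    then obtain y where "e = {x, y}"
      using spanning_tree_edgeE[OF assms, of e] by (auto simp: insert_commute)
    then show "e \<in> (\<lambda>y. {x, y}) ` {y. {x, y} \<in> T}" using e by blast
  qed auto
  moreover have "inj_on (\<lambda>y. {x, y}) {y. {x, y} \<in> T}"
    by (auto simp: inj_on_def doubleton_eq_iff)
  ultimately show ?thesis by (simp add: card_image)
qed

lemma two_edges_not_leaf:
  assumes "{x, y} \<in> T" "{x, z} \<in> T" "y \<noteq> z"
  shows "\<not> is_leaf T x"
proof
  assume "is_leaf T x"
  then obtain e where e: "{e \<in> T. x \<in> e} = {e}" by (auto simp: is_leaf_def card_1_singleton_iff)
  have "{x, y} \<in> {e \<in> T. x \<in> e}" "{x, z} \<in> {e \<in> T. x \<in> e}" using assms by auto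
  then have "{x, y} = e" "{x, z} = e" unfolding e by auto
  then show False using assms by (auto simp: doubleton_eq_iff)
qed

text \<open>
  The second vertex of a path from \<open>x\<close> to \<open>p\<close> is \<open>p\<close> itself or has two neighbours on the path.
\<close>

lemma spanning_tree_non_leaf_neighbour:
  assumes T: "is_spanning_tree V T" and "x \<in> V" "p \<in> V" "x \<noteq> p" "\<not> is_leaf T p"
  obtains z where "{x, z} \<in> T" "\<not> is_leaf T z"
proof -
  obtain xs where xs: "xs \<noteq> []" "distinct xs" "successively (edge_adj T) xs" "hd xs = x" "last xs = p"
    using spanning_tree_path[OF T assms(2,3)] by blast
  then obtain z zs where xs': "xs = x # z # zs"
    using \<open>x \<noteq> p\<close> by (metis last.simps list.exhaust_sel)
  have e: "{x, z} \<in> T" using xs xs' by (auto simp: edge_adj_def)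
  have "\<not> is_leaf T z"
  proof (cases zs)
    case Nil
    then show ?thesis using xs xs' assms(5) by auto
  next
    case (Cons w ws)
    then have "{z, x} \<in> T" "{z, w} \<in> T" "x \<noteq> w"
      using xs xs' by (auto simp: edge_adj_def insert_commute)
    then show ?thesis by (rule two_edges_not_leaf)
  qed
  then show thesis using that e by blast
qed

section \<open>Double stars\<close>

text \<open>The points of \<open>B\<close> hang on \<open>q\<close>, the others on \<open>p\<close>.
  Allowing \<open>B\<close> to be empty or all of \<open>V - {p, q}\<close> puts both stars into the
  same family as the brushes, so that an induction on \<open>B\<close> can end in a star.\<close>

definition double_star :: "'a set \<Rightarrow> 'a \<Rightarrow> 'a \<Rightarrow> 'a set \<Rightarrow> 'a set set" where
  "double_star V p q B =
     insert {p, q} ((\<lambda>x. {if x \<in> B then q else p, x}) ` (V - {p, q}))"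

text \<open>Transfers facts about one centre to the other.\<close>

lemma double_star_swap:
  assumes "B \<subseteq> V - {p, q}"
  shows "double_star V p q B = double_star V q p (V - {p, q} - B)"
proof -
  have "(\<lambda>x. {if x \<in> B then q else p, x}) ` (V - {p, q}) =
    (\<lambda>x. {if x \<in> V - {p, q} - B then p else q, x}) ` (V - {q, p})"
    by (rule image_cong) auto
  then show ?thesis by (simp add: double_star_def insert_commute)
qed

lemma spanning_star_eq_image: "spanning_star V p = (\<lambda>y. {p, y}) ` (V - {p})"
  unfolding spanning_star_def by blast

lemma double_star_empty:
  assumes "q \<in> V" "p \<noteq> q"
  shows "double_star V p q {} = spanning_star V p"
proof -
  note spanning_star_eq_image
  also have "V - {p} = insert q (V - {p, q})" using assms by blast
  finally show ?thesis by (simp add: double_star_def)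
qed

lemma edge_double_star_iff:
  assumes "x \<in> V - {p, q}" "p \<noteq> q"
  shows "{x, y} \<in> double_star V p q B \<longleftrightarrow> y = (if x \<in> B then q else p)"
proof
  assume "{x, y} \<in> double_star V p q B"
  moreover have "{x, y} \<noteq> {p, q}" using assms by (auto simp: doubleton_eq_iff)
  ultimately obtain z where "z \<in> V - {p, q}" "{x, y} = {if z \<in> B then q else p, z}"
    unfolding double_star_def by blast
  then show "y = (if x \<in> B then q else p)"
    using assms unfolding doubleton_eq_iff by (metis DiffE insertCI)
next
  assume "y = (if x \<in> B then q else p)"
  then show "{x, y} \<in> double_star V p q B"
    using assms(1) unfolding double_star_def by blast
qed

lemma double_star_nbr:
  assumes "x \<in> V"
  shows "\<exists>c\<in>{p, q}. (edge_adj (double_star V p q B))\<^sup>=\<^sup>= x c"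
proof (cases "x \<in> {p, q}")
  case True
  then show ?thesis by blast
next
  case False
  then have "{if x \<in> B then q else p, x} \<in> double_star V p q B"
    using assms unfolding double_star_def by blast
  then have "edge_adj (double_star V p q B) x (if x \<in> B then q else p)"
    using False by (cases "x \<in> B") (simp_all add: edge_adj_def insert_commute)
  then show ?thesis by (cases "x \<in> B") simp_all
qed

lemma double_star_centres:
  assumes "c \<in> {p, q}" "d \<in> {p, q}"
  shows "(edge_adj (double_star V p q B))\<^sup>=\<^sup>= c d"
  using assms by (auto simp: edge_adj_def double_star_def insert_commute)

text \<open>Go from \<open>x\<close> to a centre, from there to a centre next to \<open>y\<close>,
  then to \<open>y\<close>, pausing where needed. This serves both connectedness and the diameter
  bound.\<close>

lemma double_star_walk3:
  assumes "x \<in> V" "y \<in> V"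
  shows "((edge_adj (double_star V p q B))\<^sup>=\<^sup>= ^^ 3) x y"
proof -
  let ?R = "(edge_adj (double_star V p q B))\<^sup>=\<^sup>="
  obtain c where c: "c \<in> {p, q}" "?R x c" using double_star_nbr[OF assms(1)] by blast
  obtain d where d: "d \<in> {p, q}" "?R y d" using double_star_nbr[OF assms(2)] by blast
  have "?R d y" using d(2) by (auto simp: edge_adj_commute)
  moreover have "?R c d" using double_star_centres[OF c(1) d(1)] .
  ultimately show ?thesis using c(2) unfolding numeral_3_eq_3 relpowp.simps by blast
qed

text \<open>Every vertex of a cycle has two neighbours, but a point other than \<open>p\<close> and
  \<open>q\<close> has only one. A cycle would thus have at most two vertices.\<close>

lemma double_star_spanning_tree:
  assumes "p \<in> V" "q \<in> V" "p \<noteq> q"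
  shows "is_spanning_tree V (double_star V p q B)"
proof -
  let ?E = "double_star V p q B"
  have "?E \<subseteq> complete_edges V"
    using assms by (auto simp: double_star_def intro!: complete_edgesI split: if_splits)
  moreover have "graph_connected V ?E"
    unfolding graph_connected_def
    using double_star_walk3[of _ V _ p q B] relpowp_imp_rtranclp rtranclp_reflclp by metis
  moreover have "\<not> graph_cycle ?E xs" for xs
  proof
    assume cyc: "graph_cycle ?E xs"
    have "set xs \<subseteq> {p, q}"
    proof
      fix x assume x: "x \<in> set xs"
      obtain y z where yz: "y \<noteq> z" "edge_adj ?E x y" "edge_adj ?E x z"
        using graph_cycle_two_neighbours[OF cyc x] by blast
      show "x \<in> {p, q}"
      proof (rule ccontr)
        assume "x \<notin> {p, q}"
        moreover have "{x, y} \<in> complete_edges V"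
          using yz \<open>?E \<subseteq> complete_edges V\<close> by (auto simp: edge_adj_def)
        then have "x \<in> V" by (auto simp: complete_edges_def doubleton_eq_iff)
        ultimately show False
          using yz edge_double_star_iff[of x V p q _ B] assms by (auto simp: edge_adj_def)
      qed
    qed
    then have "card (set xs) \<le> card {p, q}" by (intro card_mono) auto
    then show False using cyc assms by (simp add: graph_cycle_def distinct_card)
  qed
  ultimately show ?thesis using assms by (auto simp: is_spanning_tree_def)
qed

lemma spanning_star_diameter: "graph_diameter V (spanning_star V p) \<le> 2"
proof -
  let ?R = "(edge_adj (spanning_star V p))\<^sup>=\<^sup>="
  have R: "?R x p" "?R p x" if "x \<in> V" for x
    using that by (auto simp: edge_adj_def spanning_star_def insert_commute)
  have "graph_diameter V (spanning_star V p) \<le> enat 2"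
  proof (rule graph_diameter_le)
    fix x y assume "x \<in> V" "y \<in> V"
    then show "(?R ^^ 2) x y" unfolding numeral_2_eq_2 relpowp.simps using R by blast
  qed
  then show ?thesis by (simp add: numeral_eq_enat)
qed

lemma double_star_leaf:
  assumes "x \<in> V - {p, q}" "p \<in> V" "q \<in> V" "p \<noteq> q"
  shows "is_leaf (double_star V p q B) x"
proof -
  have "{y. {x, y} \<in> double_star V p q B} = {if x \<in> B then q else p}"
    using edge_double_star_iff[OF assms(1,4)] by auto
  then show ?thesis
    using card_incident_edges[OF double_star_spanning_tree[OF assms(2-4)]]
    by (simp add: is_leaf_def)
qed

lemma double_star_second_centre_not_leaf:
  assumes "B \<subseteq> V - {p, q}" "B \<noteq> {}"
  shows "\<not> is_leaf (double_star V p q B) q"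
proof -
  obtain b where "b \<in> B" using assms by blast
  then have "{q, b} \<in> double_star V p q B" "{q, p} \<in> double_star V p q B" "b \<noteq> p"
    using assms by (auto simp: double_star_def insert_commute)
  then show ?thesis by (rule two_edges_not_leaf)
qed

text \<open>As neither star is allowed, \<open>B\<close> and its complement in
  \<open>V - {p, q}\<close> are nonempty. Each centre then has a second neighbour, while all other
  points are leaves.\<close>

lemma double_star_not_star:
  assumes "p \<in> V" "q \<in> V" "p \<noteq> q" "B \<subseteq> V - {p, q}"
    and "\<not> is_star V (double_star V p q B)"
  shows "graph_diameter V (double_star V p q B) = 3"
    and "internal_edges (double_star V p q B) = {{p, q}}"
proof -
  let ?T = "double_star V p q B" and ?A = "V - {p, q} - B"
  have tree: "is_spanning_tree V ?T" using double_star_spanning_tree assms by metis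
  have swap: "?T = double_star V q p ?A" using double_star_swap assms(4) .
  have "?T \<noteq> spanning_star V p" "?T \<noteq> spanning_star V q"
    using assms(5) tree spanning_star_diameter by (metis is_star_def)+
  then have "B \<noteq> {}" "?A \<noteq> {}"
    using swap double_star_empty assms(1-3) by metis+
  have "\<not> is_leaf ?T q"
    using double_star_second_centre_not_leaf[OF assms(4) \<open>B \<noteq> {}\<close>] .
  moreover have "\<not> is_leaf ?T p"
    unfolding swap using \<open>?A \<noteq> {}\<close> by (intro double_star_second_centre_not_leaf) auto
  moreover have "{p, q} \<in> ?T" by (simp add: double_star_def)
  ultimately have "{p, q} \<in> internal_edges ?T" by (auto simp: internal_edges_def)
  moreover have "e = {p, q}" if e: "e \<in> internal_edges ?T" for e
  proof -
    have "e \<in> ?T" using e by (simp add: internal_edges_def)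
    then obtain x y where xy: "e = {x, y}" "x \<in> V" "y \<in> V" "x \<noteq> y"
      using spanning_tree_edgeE[OF tree] by blast
    then have "\<not> is_leaf ?T x" "\<not> is_leaf ?T y" using e by (auto simp: internal_edges_def)
    then have "x \<in> {p, q}" "y \<in> {p, q}"
      using double_star_leaf[of _ V p q B] assms(1-3) xy by blast+
    then show ?thesis using xy by auto
  qed
  ultimately show "internal_edges ?T = {{p, q}}" by blast
  have "graph_diameter V ?T \<le> enat 3"
    by (rule graph_diameter_le) (rule double_star_walk3)
  moreover have "\<not> graph_diameter V ?T \<le> enat 2"
    using assms(5) tree by (simp add: is_star_def numeral_eq_enat)
  ultimately show "graph_diameter V ?T = 3"
    by (cases "graph_diameter V ?T") (auto simp: numeral_eq_enat)
qed

text \<open>A third non-leaf would have a non-leaf neighbour and so give a second internal edge.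
  Hence every other point is a leaf hanging on \<open>p\<close> or \<open>q\<close>, so
  \<open>T\<close> contains a double star and equals it.\<close>

lemma double_star_if_internal_edges:
  assumes T: "is_spanning_tree V T" and int: "internal_edges T = {{p, q}}"
  shows "T = double_star V p q {x \<in> V - {p, q}. {q, x} \<in> T}"
proof -
  have pq: "{p, q} \<in> T" "\<not> is_leaf T p" "\<not> is_leaf T q"
    using int by (auto simp: internal_edges_def)
  have V: "p \<in> V" "q \<in> V" using spanning_tree_edge_adj[OF T pq(1)] by auto
  have nonleaf: "x \<in> {p, q}" if x_in: "x \<in> V" "\<not> is_leaf T x" for x
  proof (rule ccontr)
    assume x: "x \<notin> {p, q}"
    then obtain z where "{x, z} \<in> T" "\<not> is_leaf T z"
      using spanning_tree_non_leaf_neighbour[OF T x_in(1) V(1)] pq by blast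
    then have "{x, z} \<in> internal_edges T" using x_in by (auto simp: internal_edges_def)
    then show False using int x by auto
  qed
  have nbr: "{p, x} \<in> T \<or> {q, x} \<in> T" if x_in: "x \<in> V - {p, q}" for x
  proof -
    obtain z where z: "{x, z} \<in> T" "\<not> is_leaf T z"
      using spanning_tree_non_leaf_neighbour[OF T _ V(1), of x] x_in pq by blast
    then have "z \<in> {p, q}" using nonleaf spanning_tree_edge_adj[OF T z(1)] by blast
    then show ?thesis using z by (auto simp: insert_commute)
  qed
  have "double_star V p q {x \<in> V - {p, q}. {q, x} \<in> T} \<subseteq> T"
  proof
    fix e assume "e \<in> double_star V p q {x \<in> V - {p, q}. {q, x} \<in> T}"
    then consider "e = {p, q}" | x where "x \<in> V - {p, q}" "e = {if {q, x} \<in> T then q else p, x}"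
      unfolding double_star_def by auto
    then show "e \<in> T" using pq(1) nbr by cases auto
  qed
  moreover have "p \<noteq> q" using spanning_tree_edge_adj[OF T pq(1)] by (auto simp: edge_adj_def)
  ultimately show ?thesis
    using spanning_tree_subset_eq[OF double_star_spanning_tree T] V by metis
qed

text \<open>If \<open>{p, q}\<close> were no edge, both neighbourhoods would lie in
  \<open>V - {p, q}\<close> and share at most one point, as two would give a 4-cycle; the degree sum
  would be at most \<open>card V - 1\<close>. With \<open>{p, q}\<close> an edge, a common neighbour
  would give a triangle, so the neighbourhoods are disjoint and cover \<open>V\<close>.\<close>

lemma double_star_if_degree_sum:
  assumes "finite V" "p \<noteq> q" "p \<in> V" "q \<in> V" and T: "is_spanning_tree V T"
    and deg: "card V \<le> card {e \<in> T. p \<in> e} + card {e \<in> T. q \<in> e}"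
  shows "T = double_star V p q {x \<in> V - {p, q}. {q, x} \<in> T}"
proof -
  let ?N = "\<lambda>x. {y. {x, y} \<in> T}"
  have sub: "?N x \<subseteq> V - {x}" for x
    using spanning_tree_edge_adj[OF T] by (auto simp: edge_adj_def)
  then have fin: "finite (?N x)" for x using \<open>finite V\<close> by (meson finite_Diff finite_subset)
  have sum: "card V \<le> card (?N p \<union> ?N q) + card (?N p \<inter> ?N q)"
    using deg card_incident_edges[OF T] card_Un_Int[OF fin fin] by metis
  have V2: "2 \<le> card V"
    using card_mono[of V "{p, q}"] assms(1-4) by auto
  have pq: "{p, q} \<in> T"
  proof (rule ccontr)
    assume "{p, q} \<notin> T"
    then have "?N p \<union> ?N q \<subseteq> V - {p, q}"
      using sub[of p] sub[of q] by (auto simp: insert_commute)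
    then have "card (?N p \<union> ?N q) \<le> card (V - {p, q})"
      using \<open>finite V\<close> by (intro card_mono) auto
    also have "\<dots> = card V - 2" using assms by (simp add: card_Diff_subset)
    finally have "card (?N p \<union> ?N q) \<le> card V - 2" .
    moreover have "card (?N p \<inter> ?N q) \<le> 1"
    proof -
      have "x = y" if "x \<in> ?N p \<inter> ?N q" "y \<in> ?N p \<inter> ?N q" for x y
        using spanning_tree_no_square[OF T, of p x q y] that \<open>p \<noteq> q\<close>
        by (auto simp: insert_commute)
      then show ?thesis using fin by (metis One_nat_def card_le_Suc0_iff_eq finite_Int)
    qed
    ultimately show False using sum V2 by linarith
  qed
  have "?N p \<inter> ?N q = {}"
    using spanning_tree_no_triangle[OF T, of p q] pq by (auto simp: insert_commute)
  then have "card V \<le> card (?N p \<union> ?N q)" using sum by simp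
  moreover have "?N p \<union> ?N q \<subseteq> V" using sub by blast
  ultimately have "?N p \<union> ?N q = V" using \<open>finite V\<close> card_seteq by metis
  then have "double_star V p q {x \<in> V - {p, q}. {q, x} \<in> T} \<subseteq> T"
    using pq by (auto simp: double_star_def split: if_splits)
  then show ?thesis
    using spanning_tree_subset_eq[OF double_star_spanning_tree T] assms by metis
qed

section \<open>Distances to a star\<close>

text \<open>Since neither of two distinct spanning trees contains the other, at least one of the two
  differing edges belongs to \<open>A\<close>, and at most one edge is gained.\<close>

lemma sst_adj_degree:
  assumes "finite P" "sst_adj P A B"
  shows "card {e \<in> B. p \<in> e} \<le> card {e \<in> A. p \<in> e} + 1"
proof -
  have A: "is_spanning_tree P A" and B: "is_spanning_tree P B" and c: "card (sym_diff A B) = 2"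
    using assms by (auto simp: sst_adj_def SST_def)
  have fin: "finite A" "finite B"
    using A B finite_spanning_tree[OF assms(1)] by auto
  have "card (sym_diff A B) = card (A - B) + card (B - A)"
    using fin by (intro card_Un_disjoint) auto
  moreover have "card (A - B) \<noteq> 0"
    using spanning_tree_subset_eq[OF A B] fin c by auto
  ultimately have "card (B - A) \<le> 1" using c by linarith
  have "card {e \<in> B. p \<in> e} \<le> card ({e \<in> A. p \<in> e} \<union> (B - A))"
    using fin by (intro card_mono) auto
  also have "\<dots> \<le> card {e \<in> A. p \<in> e} + card (B - A)" by (rule card_Un_le)
  finally show ?thesis using \<open>card (B - A) \<le> 1\<close> by linarith
qed

lemma sst_walk_degree:
  assumes "finite P" "(sst_adj P ^^ k) A B"
  shows "card {e \<in> B. p \<in> e} \<le> card {e \<in> A. p \<in> e} + k"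
  using assms(2)
proof (induction k arbitrary: B)
  case 0
  then show ?case by simp
next
  case (Suc k)
  then obtain C where "(sst_adj P ^^ k) A C" "sst_adj P C B" by auto
  then show ?case using Suc.IH[of C] sst_adj_degree[OF assms(1), of C B p] by force
qed

text \<open>The degree of \<open>p\<close> must rise to \<open>card P - 1\<close>, by at most one
  per exchange. The additive form also covers an infinite distance.\<close>

lemma sst_dist_star_ge:
  assumes "finite P" "p \<in> P"
  shows "enat (card P - 1) \<le> enat (card {e \<in> T. p \<in> e}) + sst_dist P T (spanning_star P p)"
proof -
  have eq: "{e \<in> spanning_star P p. p \<in> e} = (\<lambda>y. {p, y}) ` (P - {p})"
    unfolding spanning_star_eq_image by blast
  have "card ((\<lambda>y. {p, y}) ` (P - {p})) = card (P - {p})"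
    by (intro card_image) (auto simp: inj_on_def doubleton_eq_iff)
  then have S: "card {e \<in> spanning_star P p. p \<in> e} = card P - 1"
    using assms eq by simp
  have "enat (card P - 1 - card {e \<in> T. p \<in> e}) \<le> sst_dist P T (spanning_star P p)"
    unfolding sst_dist_def
  proof (rule graph_dist_ge)
    fix k assume "(sst_adj P ^^ k) T (spanning_star P p)"
    from sst_walk_degree[OF assms(1) this, of p] S
    show "enat (card P - 1 - card {e \<in> T. p \<in> e}) \<le> enat k" by simp
  qed
  then show ?thesis
    by (cases "sst_dist P T (spanning_star P p)") auto
qed

section \<open>Crossings and oriented areas\<close>

lemma edges_cross_doubletons:
  assumes "edges_cross {a, b} {c, d}"
  shows "closed_segment a b \<inter> closed_segment c d \<noteq> {}"
  using assms by (auto simp: edges_cross_def doubleton_eq_iff closed_segment_commute)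

lemma edges_cross_disjoint: "edges_cross e f \<Longrightarrow> e \<inter> f = {}"
  by (auto simp: edges_cross_def)

lemma edges_cross_sym:
  assumes "edges_cross e f"
  shows "edges_cross f e"
proof -
  obtain a b c d where "e = {a, b}" "f = {c, d}" "distinct [a, b, c, d]"
    "closed_segment a b \<inter> closed_segment c d \<noteq> {}"
    using assms unfolding edges_cross_def by blast
  then have "f = {c, d} \<and> e = {a, b} \<and> distinct [c, d, a, b] \<and>
    closed_segment c d \<inter> closed_segment a b \<noteq> {}" by auto
  then show ?thesis unfolding edges_cross_def by blast
qed

text \<open>Twice the signed area of the triangle \<open>p\<close>, \<open>q\<close>,
  \<open>x\<close>, that is, the determinant of \<open>q - p\<close> and
  \<open>x - p\<close>.\<close>

definition area2 :: "real^2 \<Rightarrow> real^2 \<Rightarrow> real^2 \<Rightarrow> real" where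
  "area2 p q x = (q$1 - p$1) * (x$2 - p$2) - (q$2 - p$2) * (x$1 - p$1)"

lemma collinear_if_area2_eq_0:
  assumes "area2 p q x = 0" "p \<noteq> q"
  shows "collinear {p, q, x}"
proof -
  have "q - p \<noteq> 0" using assms by simp
  \<comment> \<open>The factor is read off in a coordinate in which \<open>p\<close> and
    \<open>q\<close> differ.\<close>
  obtain c where c: "x - p = c *\<^sub>R (q - p)"
  proof (cases "q$1 = p$1")
    case True
    then have ne: "q$2 \<noteq> p$2" using assms(2) by (auto simp: vec_eq_iff forall_2)
    then have "x$1 = p$1" using assms(1) True by (simp add: area2_def)
    then have "x - p = ((x$2 - p$2) / (q$2 - p$2)) *\<^sub>R (q - p)"
      using ne True by (simp add: vec_eq_iff forall_2)
    then show ?thesis using that by blast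
  next
    case False
    then have "x$2 - p$2 = (x$1 - p$1) / (q$1 - p$1) * (q$2 - p$2)"
      using assms(1) by (simp add: area2_def field_simps)
    then have "x - p = ((x$1 - p$1) / (q$1 - p$1)) *\<^sub>R (q - p)"
      using False by (simp add: vec_eq_iff forall_2)
    then show ?thesis using that by blast
  qed
  have "collinear {0, q - p, x - p}"
    by (auto simp: collinear_lemma c)
  then have "collinear {q, p, x}" by (subst collinear_3) auto
  then show ?thesis by (simp add: insert_commute)
qed

text \<open>Choose \<open>b\<close> with the largest angle \<open>qpb\<close>. A common point of
  \<open>[p, b]\<close> and \<open>[q, c]\<close> is seen from \<open>p\<close> at the angle of
  \<open>b\<close>, which on the segment from \<open>q\<close> to \<open>c\<close> is below the
  angle of \<open>c\<close> unless the point is \<open>c\<close> itself; general position excludes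
  that case. Minimal cotangent means maximal angle, and the absolute value in \<open>f\<close>
  treats both sides of the line \<open>pq\<close> alike.\<close>

lemma exists_uncrossed_reattachment:
  assumes "general_position P" "p \<in> P" "q \<in> P" "p \<noteq> q" "finite B" "B \<noteq> {}" "B \<subseteq> P - {p, q}"
  shows "\<exists>b\<in>B. \<forall>c\<in>B - {b}. closed_segment p b \<inter> closed_segment q c = {}"
proof -
  define h where "h x = (x - p) \<bullet> (q - p)" for x
  \<comment> \<open>the cotangent of the angle \<open>qpx\<close>\<close>
  define f where "f x = h x / \<bar>area2 p q x\<bar>" for x
  have nz: "area2 p q x \<noteq> 0" if "x \<in> B" for x
  proof
    assume "area2 p q x = 0"
    then have "collinear {p, q, x}" using collinear_if_area2_eq_0 assms(4) by blast
    moreover have "distinct [p, q, x]" "x \<in> P" using that assms(4,7) by auto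
    ultimately show False using assms(1-3) by (auto simp: general_position_def)
  qed
  obtain b where b: "b \<in> B" "\<And>c. c \<in> B \<Longrightarrow> f b \<le> f c"
    using arg_min_if_finite(1)[OF assms(5,6), of f] arg_min_least[OF assms(5,6), of _ f] by blast
  have "closed_segment p b \<inter> closed_segment q c = {}" if c: "c \<in> B - {b}" for c
  proof (rule ccontr)
    assume "closed_segment p b \<inter> closed_segment q c \<noteq> {}"
    then obtain s t where st: "0 \<le> s" "s \<le> 1" "0 \<le> t" "t \<le> 1"
      and eq: "(1 - s) *\<^sub>R p + s *\<^sub>R b = (1 - t) *\<^sub>R q + t *\<^sub>R c"
      by (auto simp: closed_segment_def)
    have eq': "s *\<^sub>R (b - p) = (1 - t) *\<^sub>R (q - p) + t *\<^sub>R (c - p)"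
      using eq by (simp add: algebra_simps)
    have comp: "s * (b$i - p$i) = (1 - t) * (q$i - p$i) + t * (c$i - p$i)" for i
      using arg_cong[OF eq', of "\<lambda>v. v$i"] by simp
    \<comment> \<open>The determinant with \<open>q - p\<close> removes the \<open>q - p\<close>
      term: both sides measure the height of the common point over the line
      \<open>pq\<close>.\<close>
    have "s * area2 p q b = (q$1 - p$1) * (s * (b$2 - p$2)) - (q$2 - p$2) * (s * (b$1 - p$1))"
      by (simp add: area2_def algebra_simps)
    also have "\<dots> = t * area2 p q c"
      unfolding comp by (simp add: area2_def algebra_simps)
    finally have area: "s * area2 p q b = t * area2 p q c" .
    have dot: "s * h b = (1 - t) * ((q - p) \<bullet> (q - p)) + t * h c"
      using arg_cong[OF eq', of "\<lambda>v. v \<bullet> (q - p)"] by (simp add: h_def inner_add_left)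
    \<comment> \<open>By \<open>area\<close>, if one of them vanishes then so does the other, and
      \<open>eq'\<close> would give \<open>p = q\<close>.\<close>
    have "s \<noteq> 0 \<and> t \<noteq> 0"
      using area nz b(1) c eq' assms(4) by force
    with st have pos: "0 < s" "0 < t" by auto
    \<comment> \<open>A common denominator for both cotangents, so that comparing them means
      comparing \<open>s * h b\<close> with \<open>t * h c\<close>.\<close>
    define m where "m = s * \<bar>area2 p q b\<bar>"
    have m: "0 < m" "m = t * \<bar>area2 p q c\<bar>"
      using area pos nz[OF b(1)] unfolding m_def by (simp_all add: abs_mult[symmetric] flip: abs_of_pos)
        (metis abs_mult abs_of_pos)
    have "f b = s * h b / m" using pos by (simp add: f_def m_def)
    moreover have "f c = t * h c / m" using pos by (simp add: f_def m(2))
    moreover have "f b \<le> f c" using b(2) c by blast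
    ultimately have "s * h b \<le> t * h c" using m(1) by (simp add: divide_le_cancel)
    then have "(1 - t) * ((q - p) \<bullet> (q - p)) \<le> 0" using dot by linarith
    moreover have "0 < (q - p) \<bullet> (q - p)" using assms(4) by simp
    ultimately have "t = 1" using st by (simp add: mult_le_0_iff)
    \<comment> \<open>With \<open>t = 1\<close> the common point is \<open>c\<close>, which
      therefore lies on the line through \<open>p\<close> and \<open>b\<close>.\<close>
    then have "c - p = s *\<^sub>R (b - p)" using eq' by simp
    then have "collinear {0, b - p, c - p}" by (auto simp: collinear_lemma)
    then have "collinear {b, p, c}" by (subst collinear_3) auto
    moreover have "distinct [b, p, c]" "b \<in> P" "c \<in> P" using b c assms(7) by auto
    ultimately show False using assms(1,2) by (auto simp: general_position_def)
  qed
  then show ?thesis using b by blast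
qed

section \<open>Distances from a double star to its two stars\<close>

text \<open>Each exchange replaces \<open>{q, b}\<close> by \<open>{p, b}\<close> for a suitable
  \<open>b\<close> and removes \<open>b\<close> from \<open>B\<close>; after \<open>card B\<close>
  exchanges the star at \<open>p\<close> is left.\<close>

lemma double_star_dist_le:
  assumes "finite P" "general_position P" "p \<in> P" "q \<in> P" "p \<noteq> q"
    and "B \<subseteq> P - {p, q}" "double_star P p q B \<in> SST P"
  shows "sst_dist P (double_star P p q B) (spanning_star P p) \<le> enat (card B)"
proof -
  have "(sst_adj P ^^ card B) (double_star P p q B) (spanning_star P p)"
    using assms(6,7)
  proof (induction "card B" arbitrary: B)
    case 0
    then have "B = {}" using assms(1) by (metis card_0_eq finite_Diff finite_subset)
    then show ?case using double_star_empty assms by simp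
  next
    case (Suc k)
    let ?T = "double_star P p q B"
    have "finite B" using Suc assms(1) finite_subset by blast
    have "B \<noteq> {}" using Suc(2) by auto
    obtain b where b: "b \<in> B" "\<And>c. c \<in> B - {b} \<Longrightarrow> closed_segment p b \<inter> closed_segment q c = {}"
      using exists_uncrossed_reattachment[OF assms(2-5) \<open>finite B\<close> \<open>B \<noteq> {}\<close> Suc(3)] by blast
    let ?T' = "double_star P p q (B - {b})"
    have bP: "b \<in> P" "b \<noteq> p" "b \<noteq> q" using b Suc(3) by auto
    \<comment> \<open>The edges avoiding \<open>b\<close>, which are the same in both trees.\<close>
    define C where "C = insert {p, q} ((\<lambda>x. {if x \<in> B then q else p, x}) ` (P - {p, q, b}))"
    have P: "P - {p, q} = insert b (P - {p, q, b})" using bP by blast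
    have T: "?T = insert {q, b} C"
      unfolding double_star_def P image_insert C_def using b(1) by (simp add: insert_commute)
    have "(\<lambda>x. {if x \<in> B - {b} then q else p, x}) ` (P - {p, q, b}) =
        (\<lambda>x. {if x \<in> B then q else p, x}) ` (P - {p, q, b})"
      by (rule image_cong) auto
    then have T': "?T' = insert {p, b} C"
      unfolding double_star_def P image_insert C_def by (simp add: insert_commute)
    have "{b, q} \<notin> ?T'" "{b, p} \<notin> ?T"
      using edge_double_star_iff[of b P p q _ "B - {b}"] edge_double_star_iff[of b P p q _ B]
        bP assms(5) b(1) by auto
    then have "{q, b} \<notin> ?T'" "{p, b} \<notin> ?T" by (simp_all add: insert_commute)
    then have "sym_diff ?T ?T' = {{q, b}, {p, b}}" using T T' by blast
    moreover have "{q, b} \<noteq> {p, b}" using assms(5) by (auto simp: doubleton_eq_iff)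
    ultimately have card: "card (sym_diff ?T ?T') = 2" by simp
    \<comment> \<open>A crossing edge must avoid \<open>p\<close>, so it joins \<open>q\<close> to
      some \<open>c\<close> in \<open>B - {b}\<close>; the choice of \<open>b\<close> rules this
      out.\<close>
    have nc: "\<not> edges_cross {p, b} f" if "f \<in> ?T'" for f
    proof
      assume cr: "edges_cross {p, b} f"
      then have "p \<notin> f" using edges_cross_disjoint by blast
      moreover from this obtain c where "f = {if c \<in> B - {b} then q else p, c}"
        using \<open>f \<in> ?T'\<close> unfolding double_star_def by blast
      ultimately have "c \<in> B - {b}" "f = {q, c}" by (auto split: if_splits)
      then show False using b(2) cr edges_cross_doubletons by blast
    qed
    have "\<not> edges_cross e f" if "e \<in> ?T'" "f \<in> ?T'" for e f
    proof (cases "e = {p, b} \<or> f = {p, b}")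
      case True
      then show ?thesis using nc[OF that(1)] nc[OF that(2)] edges_cross_sym[of e f] by auto
    next
      case False
      then have "e \<in> ?T" "f \<in> ?T" using that unfolding T T' by auto
      then show ?thesis using Suc(4) by (auto simp: SST_def)
    qed
    then have "?T' \<in> SST P" using double_star_spanning_tree[OF assms(3-5)] by (simp add: SST_def)
    moreover have k: "k = card (B - {b})" using Suc(2) b(1) \<open>finite B\<close> by simp
    ultimately have "(sst_adj P ^^ k) ?T' (spanning_star P p)"
      using Suc(1)[OF k] Suc(3) by (metis Diff_subset order_trans)
    moreover have "sst_adj P ?T ?T'"
      using card Suc(4) \<open>?T' \<in> SST P\<close> by (simp add: sst_adj_def)
    ultimately show ?case unfolding Suc(2)[symmetric] by (metis relpowp_Suc_I2)
  qed
  then show ?thesis unfolding sst_dist_def by (rule graph_dist_le)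
qed

text \<open>Reattaching \<open>B\<close> to \<open>p\<close>, or the remaining points to
  \<open>q\<close>, takes at most \<open>card P - 2\<close> exchanges in total. The degree bound at
  both centres shows that fewer cannot suffice.\<close>

lemma double_star_dist_sum:
  assumes "finite P" "general_position P" "p \<in> P" "q \<in> P" "p \<noteq> q"
    and B: "B \<subseteq> P - {p, q}" and T: "double_star P p q B \<in> SST P"
  shows "sst_dist P (double_star P p q B) (spanning_star P p) +
    sst_dist P (double_star P p q B) (spanning_star P q) = enat (card P - 2)"
    (is "?dp + ?dq = _")
proof (rule antisym)
  let ?T = "double_star P p q B" and ?A = "P - {p, q} - B"
  have swap: "?T = double_star P q p ?A" using double_star_swap[OF B] .
  have fB: "finite B" using B assms(1) finite_subset by blast
  have card2: "card (P - {p, q}) = card P - 2"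
    using assms(1,3-5) by (simp add: card_Diff_subset)
  have "card ?A + card B = card (P - {p, q})"
    using B fB assms(1) by (metis card_Diff_subset card_mono finite_Diff le_add_diff_inverse2)
  then have PA: "card ?A + card B = card P - 2" using card2 by simp
  have "?dp \<le> enat (card B)" using double_star_dist_le[OF assms] .
  moreover have "?dq \<le> enat (card ?A)"
    unfolding swap using assms swap by (intro double_star_dist_le) auto
  ultimately have "?dp + ?dq \<le> enat (card B) + enat (card ?A)" by (rule add_mono)
  then show "?dp + ?dq \<le> enat (card P - 2)" using PA by (simp add: add.commute)

  \<comment> \<open>For the lower bound: \<open>{p, q}\<close> is the only edge that can be counted
    twice, and there are at most \<open>card P - 1\<close> edges. The degrees thus sum to at most
    \<open>card P\<close>, and 2(n - 1) - n = n - 2 for n = \<open>card P\<close>.\<close>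
  let ?p = "{e \<in> ?T. p \<in> e}" and ?q = "{e \<in> ?T. q \<in> e}"
  have tree: "is_spanning_tree P ?T" using T by (simp add: SST_def)
  have fin: "finite ?T" using finite_spanning_tree[OF assms(1) tree] .
  have two: "2 \<le> card P" using card_mono[of P "{p, q}"] assms(1,3-5) by auto
  have "?p \<inter> ?q \<subseteq> {{p, q}}"
    using spanning_tree_edgeE[OF tree] assms(5) by blast
  then have "card (?p \<inter> ?q) \<le> card {{p, q}}" by (intro card_mono) auto
  moreover have "card (?p \<union> ?q) \<le> card ?T" using fin by (intro card_mono) auto
  moreover have "card ?T \<le> Suc (card P - 2)"
  proof -
    have "card ?T \<le> Suc (card ((\<lambda>x. {if x \<in> B then q else p, x}) ` (P - {p, q})))"
      unfolding double_star_def using assms(1) by (subst card_insert_if) auto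
    also have "\<dots> \<le> Suc (card (P - {p, q}))"
      unfolding Suc_le_mono using assms(1) by (intro card_image_le) auto
    finally show ?thesis using card2 by simp
  qed
  moreover have "card ?p + card ?q = card (?p \<union> ?q) + card (?p \<inter> ?q)"
    using fin by (intro card_Un_Int) auto
  ultimately have "card ?p + card ?q \<le> card P" using two by simp
  moreover have "enat (card P - 1) \<le> enat (card ?p) + ?dp" "enat (card P - 1) \<le> enat (card ?q) + ?dq"
    using sst_dist_star_ge assms(1,3,4) by blast+
  ultimately show "enat (card P - 2) \<le> ?dp + ?dq"
    by (cases ?dp; cases ?dq) auto
qed

theorem theorem5:
  fixes P :: "(real^2) set" and p q :: "real^2" and n :: nat and T :: "(real^2) set set"
  assumes "finite P" and "card P = n"
    and "general_position P"
    and "p \<in> P" and "q \<in> P" and "p \<noteq> q"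
    and "T \<in> SST P"
  shows "is_brush P p q T \<longleftrightarrow>
    \<not> is_star P T \<and>
    sst_dist P T (spanning_star P p) + sst_dist P T (spanning_star P q) = enat (n - 2)"
proof -
  have tree: "is_spanning_tree P T" using assms(7) by (simp add: SST_def)
  show ?thesis
  proof (intro iffI conjI)
    assume brush: "is_brush P p q T"
    then have "graph_diameter P T = 3" and int: "internal_edges T = {{p, q}}"
      unfolding is_brush_def by blast+
    then show "\<not> is_star P T" by (simp add: is_star_def)
    obtain B where B: "B \<subseteq> P - {p, q}" and T: "T = double_star P p q B"
      by (rule that[OF _ double_star_if_internal_edges[OF tree int]]) blast
    show "sst_dist P T (spanning_star P p) + sst_dist P T (spanning_star P q) = enat (n - 2)"
      using double_star_dist_sum[OF assms(1,3-6) B] assms(2,7) unfolding T by simp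
  next
    assume r: "\<not> is_star P T \<and>
      sst_dist P T (spanning_star P p) + sst_dist P T (spanning_star P q) = enat (n - 2)"
    have "enat (n - 1) \<le> enat (card {e \<in> T. p \<in> e}) + sst_dist P T (spanning_star P p)"
      "enat (n - 1) \<le> enat (card {e \<in> T. q \<in> e}) + sst_dist P T (spanning_star P q)"
      using sst_dist_star_ge assms(1,2,4,5) by blast+
    \<comment> \<open>This makes the subtractions on naturals exact; then 2(n - 1) - (n - 2) = n.
      The distances are finite because their sum is.\<close>
    moreover have "2 \<le> n" using card_mono[of P "{p, q}"] assms by auto
    ultimately have deg: "n \<le> card {e \<in> T. p \<in> e} + card {e \<in> T. q \<in> e}"
      using r by (cases "sst_dist P T (spanning_star P p)"; cases "sst_dist P T (spanning_star P q)") auto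
    obtain B where B: "B \<subseteq> P - {p, q}" and T: "T = double_star P p q B"
      by (rule that[OF _ double_star_if_degree_sum[OF assms(1,6,4,5) tree deg[folded assms(2)]]]) blast
    have "\<not> is_star P (double_star P p q B)" using r T by simp
    from double_star_not_star[OF assms(4-6) B this]
    show "is_brush P p q T" using assms(7) by (simp add: is_brush_def T)
  qed
qed

end
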